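(* Let $L$ be a finite lattice and $\{L_i\mid i\in I\}$ a finite family of finite lattices such that $L$ is a subdirect product of them, $L\leq \prod_{i\in I}L_i$. Let $c_L$ and $i_L$ be the closure and interior operators on $\prod_{i\in I}L_i$ corresponding to $L$, i.e. $c_L(\mathbf{z})=\bigwedge\{\mathbf{u}\in L\mid \mathbf{z}\leq\mathbf{u}\}$ and $i_L(\mathbf{z})=\bigvee\{\mathbf{u}\in L\mid \mathbf{u}\leq\mathbf{z}\}$. Let $n\geq 1$ and $f\colon L^n\to L$. Then the following are equivalent: (1) $f$ is an aggregation function preserving arbitrary suprema. (2) For each $l\in\{1,\dots,n\}$ there is a system $\{f^l_{ij}\colon L_i\to L_j\mid i,j\in I\}$ of mappings preserving arbitrary suprema such that $\bigvee_{l=1}^n\bigvee_{i\in I}f^l_{ij}(1_{L_i})=1_{L_j}$ for every $j\in I$, and $$f(\mathbf{x})=\bigvee_{l=1}^n c_L\big(F_l(\mathbf{x}(l))\big)\quad\text{for all }\mathbf{x}\in L^n,$$ where $F_l\colon \prod_{i\in I}L_i\to \prod_{i\in I}L_i$ is given by $F_l(\mathbf{z})(j)=\bigvee_{i\in I}f^l_{ij}(\mathbf{z}(i))$ for $j\in I$.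
   Context: $L$ is a subdirect product of $\{L_i\}$ if $L$ is a sublattice of the (componentwise ordered) direct product $\prod_{i\in I}L_i$ and each coordinate projection maps $L$ onto $L_i$. For $\mathbf{x}\in L^n$, $\mathbf{x}(l)\in L\subseteq\prod_i L_i$ is its $l$-th coordinate, and $\mathbf{z}(i)$ is the $i$-th component of $\mathbf{z}\in\prod_i L_i$; $1_{L_i}$ is the top element of $L_i$. An aggregation function $f\colon L^n\to L$ is monotone with $f(0,\dots,0)=0$ and $f(1,\dots,1)=1$ (bottom and top of $L$). Preserving arbitrary suprema includes the empty supremum. *)

theory Defs
  imports "HOL-Algebra.Complete_Lattice"
begin

text \<open>HOL-Algebra's \<^locale>\<open>lattice\<close> admits an empty carrier; a finite lattice here has a
  bottom and a top, hence is nonempty.\<close>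

definition finite_lattice :: "'a gorder \<Rightarrow> bool" where
  "finite_lattice L \<longleftrightarrow> lattice L \<and> finite (carrier L) \<and> carrier L \<noteq> {}"

definition product_lattice :: "'i set \<Rightarrow> ('i \<Rightarrow> 'a gorder) \<Rightarrow> ('i \<Rightarrow> 'a) gorder" where
  "product_lattice I Ls =
    \<lparr> carrier = (\<Pi>\<^sub>E i\<in>I. carrier (Ls i)),
      eq = (=),
      le = (\<lambda>x y. \<forall>i\<in>I. x i \<sqsubseteq>\<^bsub>Ls i\<^esub> y i) \<rparr>"

definition power_lattice :: "'a gorder \<Rightarrow> nat \<Rightarrow> (nat \<Rightarrow> 'a) gorder" where
  "power_lattice L n = product_lattice {1..n} (\<lambda>_. L)"

text \<open>\<open>L\<close> is a lattice in its own right whose binary operations are those of \<open>P\<close>, so the order of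
  \<open>L\<close> is the one induced by \<open>P\<close>. Neither bottom nor top is required to be shared.\<close>

definition sublattice :: "'a gorder \<Rightarrow> 'a gorder \<Rightarrow> bool" where
  "sublattice L P \<longleftrightarrow> lattice L \<and> lattice P \<and> carrier L \<subseteq> carrier P \<and>
    (\<forall>x\<in>carrier L. \<forall>y\<in>carrier L.
      x \<squnion>\<^bsub>L\<^esub> y = x \<squnion>\<^bsub>P\<^esub> y \<and> x \<sqinter>\<^bsub>L\<^esub> y = x \<sqinter>\<^bsub>P\<^esub> y)"

definition subdirect_product :: "('i \<Rightarrow> 'a) gorder \<Rightarrow> 'i set \<Rightarrow> ('i \<Rightarrow> 'a gorder) \<Rightarrow> bool" where
  "subdirect_product L I Ls \<longleftrightarrow>
    sublattice L (product_lattice I Ls) \<and> (\<forall>i\<in>I. (\<lambda>x. x i) ` carrier L = carrier (Ls i))"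

definition closure_op :: "'a gorder \<Rightarrow> 'a gorder \<Rightarrow> 'a \<Rightarrow> 'a" where
  "closure_op P L z = \<Sqinter>\<^bsub>P\<^esub> {u \<in> carrier L. z \<sqsubseteq>\<^bsub>P\<^esub> u}"

definition interior_op :: "'a gorder \<Rightarrow> 'a gorder \<Rightarrow> 'a \<Rightarrow> 'a" where
  "interior_op P L z = \<Squnion>\<^bsub>P\<^esub> {u \<in> carrier L. u \<sqsubseteq>\<^bsub>P\<^esub> z}"

definition aggregation_function :: "nat \<Rightarrow> 'a gorder \<Rightarrow> ((nat \<Rightarrow> 'a) \<Rightarrow> 'a) \<Rightarrow> bool" where
  "aggregation_function n L f \<longleftrightarrow>
    f \<in> carrier (power_lattice L n) \<rightarrow> carrier L \<and>
    isotone (power_lattice L n) L f \<and>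
    f (\<lambda>l\<in>{1..n}. \<bottom>\<^bsub>L\<^esub>) = \<bottom>\<^bsub>L\<^esub> \<and>
    f (\<lambda>l\<in>{1..n}. \<top>\<^bsub>L\<^esub>) = \<top>\<^bsub>L\<^esub>"

definition system_map ::
  "'i set \<Rightarrow> ('i \<Rightarrow> 'a gorder) \<Rightarrow> ('i \<Rightarrow> 'i \<Rightarrow> 'a \<Rightarrow> 'a) \<Rightarrow> ('i \<Rightarrow> 'a) \<Rightarrow> ('i \<Rightarrow> 'a)" where
  "system_map I Ls g z = (\<lambda>j\<in>I. \<Squnion>\<^bsub>Ls j\<^esub> ((\<lambda>i. g i j (z i)) ` I))"

end

theory Submission
  imports Defs
begin

text \<open>Both directions rest on the fact that left adjoints preserve suprema. The closure operator,
  viewed as a map from the product to \<open>L\<close>, is left adjoint to the inclusion of \<open>L\<close>, which gives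
  (2) \<open>\<Longrightarrow>\<close> (1). For the converse, the projection of \<open>L\<close> to \<open>L\<^sub>i\<close> has a left adjoint \<open>m\<^sub>i\<close>, mapping
  \<open>a\<close> to the least \<open>u \<in> L\<close> with \<open>a \<le> u i\<close>. Writing \<open>f\<^sub>l a\<close> for the value of \<open>f\<close> at the tuple with
  \<open>a\<close> in position \<open>l\<close> and \<open>\<bottom>\<close> elsewhere, one takes \<open>f\<^sup>l\<^sub>i\<^sub>j a = f\<^sub>l (m\<^sub>i a) j\<close>. Every \<open>x \<in> L\<close> is the
  supremum of the elements \<open>m\<^sub>i (x i)\<close>, so that \<open>F\<^sub>l x = f\<^sub>l x\<close> already lies in \<open>L\<close>.\<close>

section \<open>Complete lattices\<close>

lemma (in complete_lattice) sup_eqI: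
  assumes "A \<subseteq> carrier L" "s \<in> carrier L" "\<And>x. x \<in> A \<Longrightarrow> x \<sqsubseteq> s"
    and "\<And>y. y \<in> carrier L \<Longrightarrow> (\<And>x. x \<in> A \<Longrightarrow> x \<sqsubseteq> y) \<Longrightarrow> s \<sqsubseteq> y"
  shows "\<Squnion>A = s"
proof (rule le_antisym)
  show "\<Squnion>A \<sqsubseteq> s" using assms by (intro sup_least) auto
  show "s \<sqsubseteq> \<Squnion>A" by (intro assms(4) sup_closed sup_upper assms(1))
qed (use assms in auto)

text \<open>The form of the universal property that suits the adjunction arguments below: a supremum
  is known once its upper bounds are known.\<close>

lemma (in complete_lattice) sup_le_iff:
  assumes "A \<subseteq> carrier L" "z \<in> carrier L"
  shows "\<Squnion>A \<sqsubseteq> z \<longleftrightarrow> (\<forall>x\<in>A. x \<sqsubseteq> z)"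
proof
  assume le: "\<Squnion>A \<sqsubseteq> z"
  show "\<forall>x\<in>A. x \<sqsubseteq> z"
  proof
    fix x assume "x \<in> A"
    with assms show "x \<sqsubseteq> z"
      by (intro le_trans[OF sup_upper le]) (auto intro: sup_closed)
  qed
next
  assume "\<forall>x\<in>A. x \<sqsubseteq> z"
  then show "\<Squnion>A \<sqsubseteq> z" using assms by (intro sup_least) auto
qed

lemma (in complete_lattice) sup_empty: "\<Squnion>{} = \<bottom>"
  using weak_sup_empty eq_is_equal by simp

lemma (in complete_lattice) inf_empty: "\<Sqinter>{} = \<top>"
  using weak_inf_empty eq_is_equal by simp

lemma (in complete_lattice) sup_insert:
  "a \<in> carrier L \<Longrightarrow> A \<subseteq> carrier L \<Longrightarrow> \<Squnion>insert a A = a \<squnion> \<Squnion>A"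
  using weak_sup_insert eq_is_equal by simp

lemma (in complete_lattice) inf_insert:
  "a \<in> carrier L \<Longrightarrow> A \<subseteq> carrier L \<Longrightarrow> \<Sqinter>insert a A = a \<sqinter> \<Sqinter>A"
  using weak_inf_insert eq_is_equal by simp

text \<open>Makes facts such as \<open>sup_closed\<close> available for an explicitly named lattice,
  for example a factor \<open>Ls i\<close> with varying \<open>i\<close>, where no interpretation is
  in scope.\<close>

lemma complete_lattice_weak:
  assumes "complete_lattice L"
  shows "weak_complete_lattice L"
proof -
  interpret complete_lattice L by fact
  show ?thesis by unfold_locales
qed

text \<open>A top element together with infima of nonempty sets is enough for completeness. Both
  exist by finiteness: the top is the join of the nonempty carrier, and every nonempty subset is
  finite.\<close>

lemma finite_lattice_complete:
  assumes "finite_lattice L"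
  shows "complete_lattice L"
proof -
  interpret L: lattice L using assms by (simp add: finite_lattice_def)
  have fin: "finite (carrier L)" and ne: "carrier L \<noteq> {}"
    using assms by (auto simp: finite_lattice_def)
  show ?thesis
  proof (rule L.complete_lattice_criterion1)
    have "least L (\<Squnion>\<^bsub>L\<^esub>carrier L) (Upper L (carrier L))"
      using fin ne by (intro L.finite_sup_least) auto
    then show "\<exists>g. greatest L g (carrier L)"
      by (meson greatest_def least_Upper_above least_closed subset_refl)
    show "\<exists>i. is_glb L i A" if "A \<subseteq> carrier L" "A \<noteq> {}" for A
      using that fin by (meson L.finite_inf_greatest finite_subset)
  qed
qed

section \<open>Product lattices\<close>

lemma carrier_product_lattice [simp]:
  "carrier (product_lattice I Ls) = (\<Pi>\<^sub>E i\<in>I. carrier (Ls i))"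
  by (simp add: product_lattice_def)

lemma eq_product_lattice [simp]: "(.=\<^bsub>product_lattice I Ls\<^esub>) = (=)"
  by (simp add: product_lattice_def)

lemma le_product_lattice:
  "x \<sqsubseteq>\<^bsub>product_lattice I Ls\<^esub> y \<longleftrightarrow> (\<forall>i\<in>I. x i \<sqsubseteq>\<^bsub>Ls i\<^esub> y i)"
  by (simp add: product_lattice_def)

text \<open>Infima are formed coordinate by coordinate, and a partial order with all infima is a
  complete lattice.\<close>

lemma product_lattice_complete:
  assumes "\<And>i. i \<in> I \<Longrightarrow> complete_lattice (Ls i)"
  shows "complete_lattice (product_lattice I Ls)" (is "complete_lattice ?P")
proof -
  have po: "partial_order (Ls i)" if "i \<in> I" for i
    using assms[OF that] by (simp add: complete_lattice_def)
  then have wpo: "weak_partial_order (Ls i)" if "i \<in> I" for i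
    using that by (simp add: partial_order_def)
  have inf_greatest: "greatest (Ls i) (\<Sqinter>\<^bsub>Ls i\<^esub>B) (Lower (Ls i) B)"
    if "i \<in> I" "B \<subseteq> carrier (Ls i)" for i B
  proof -
    interpret complete_lattice "Ls i" using assms that by simp
    show ?thesis using that inf_glb by simp
  qed
  interpret partial_order ?P
  proof
    fix x y assume le: "x \<sqsubseteq>\<^bsub>?P\<^esub> y" "y \<sqsubseteq>\<^bsub>?P\<^esub> x" and car: "x \<in> carrier ?P" "y \<in> carrier ?P"
    have "x i = y i" if "i \<in> I" for i
      using le car that
      by (intro partial_order.le_antisym[OF po[OF that]]) (auto simp: le_product_lattice)
    \<comment> \<open>The carrier consists of extensional functions, so agreement on
      \<open>I\<close> is equality.\<close>
    with car show "x .=\<^bsub>?P\<^esub> y" by (auto intro: PiE_ext)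
  next
    fix x y z
    assume *: "x \<sqsubseteq>\<^bsub>?P\<^esub> y" "y \<sqsubseteq>\<^bsub>?P\<^esub> z" "x \<in> carrier ?P" "y \<in> carrier ?P" "z \<in> carrier ?P"
    have "x i \<sqsubseteq>\<^bsub>Ls i\<^esub> z i" if "i \<in> I" for i
      by (rule weak_partial_order.le_trans[OF wpo[OF that], of _ "y i"])
        (use * that in \<open>auto simp: le_product_lattice\<close>)
    then show "x \<sqsubseteq>\<^bsub>?P\<^esub> z" by (simp add: le_product_lattice)
  next
    fix x assume "x \<in> carrier ?P"
    then show "x \<sqsubseteq>\<^bsub>?P\<^esub> x"
      by (auto simp: le_product_lattice intro!: weak_partial_order.le_refl[OF wpo])
  qed auto
  have glb: "\<exists>s. is_glb ?P s A" if A: "A \<subseteq> carrier ?P" for A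
  proof -
    let ?s = "\<lambda>i\<in>I. \<Sqinter>\<^bsub>Ls i\<^esub> ((\<lambda>x. x i) ` A)"
    have g: "greatest (Ls i) (?s i) (Lower (Ls i) ((\<lambda>x. x i) ` A))" if "i \<in> I" for i
      using that A inf_greatest[of i "(\<lambda>x. x i) ` A"] by (auto dest: PiE_mem)
    have Ai: "(\<lambda>x. x i) ` A \<subseteq> carrier (Ls i)" if "i \<in> I" for i
      using that A by (auto dest: PiE_mem)
    show ?thesis
    proof (rule exI[of _ ?s])
      show "greatest ?P ?s (Lower ?P A)"
      proof (rule greatest_LowerI[OF _ _ A])
        show "?s \<sqsubseteq>\<^bsub>?P\<^esub> x" if x: "x \<in> A" for x
          unfolding le_product_lattice
        proof
          fix i assume i: "i \<in> I"
          show "?s i \<sqsubseteq>\<^bsub>Ls i\<^esub> x i"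
            by (rule greatest_Lower_below[OF g[OF i] imageI[OF x] Ai[OF i]])
        qed
        show "y \<sqsubseteq>\<^bsub>?P\<^esub> ?s" if y: "y \<in> Lower ?P A" for y
          unfolding le_product_lattice
        proof
          fix i assume i: "i \<in> I"
          have "y \<in> carrier ?P" "\<And>x. x \<in> A \<Longrightarrow> y \<sqsubseteq>\<^bsub>?P\<^esub> x"
            using y A by (auto simp: Lower_def)
          with i have "y i \<in> Lower (Ls i) ((\<lambda>x. x i) ` A)"
            unfolding Lower_def by (auto simp: le_product_lattice)
          then show "y i \<sqsubseteq>\<^bsub>Ls i\<^esub> ?s i" by (rule greatest_le[OF g[OF i]])
        qed
        show "?s \<in> carrier ?P"
          using greatest_closed[OF g] by simp
      qed
    qed
  qed
  show ?thesis
  proof (rule complete_lattice_criterion1)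
    \<comment> \<open>Every element is a lower bound of the empty set, so its infimum is the
      top.\<close>
    show "\<exists>g. greatest ?P g (carrier ?P)" using glb[of "{}"] by simp
    show "\<exists>i. is_glb ?P i A" if "A \<subseteq> carrier ?P" for A
      using that by (rule glb)
  qed
qed

text \<open>Being an upper bound and lying below every upper bound are both tested one coordinate at
  a time.\<close>

lemma sup_product_lattice:
  assumes "\<And>i. i \<in> I \<Longrightarrow> complete_lattice (Ls i)" and A: "A \<subseteq> carrier (product_lattice I Ls)"
  shows "\<Squnion>\<^bsub>product_lattice I Ls\<^esub>A = (\<lambda>i\<in>I. \<Squnion>\<^bsub>Ls i\<^esub> ((\<lambda>x. x i) ` A))"
proof -
  interpret P: complete_lattice "product_lattice I Ls"
    using assms by (intro product_lattice_complete) auto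
  have Ai: "(\<lambda>x. x i) ` A \<subseteq> carrier (Ls i)" if "i \<in> I" for i
    using A that by (auto dest: PiE_mem)
  note wcl = complete_lattice_weak[OF assms(1)]
  note upper = weak_complete_lattice.sup_upper[OF wcl Ai]
    and least = weak_complete_lattice.sup_least[OF wcl Ai]
    and closed = weak_complete_lattice.sup_closed[OF wcl Ai]
  show ?thesis
  proof (rule P.sup_eqI[OF A])
    show "(\<lambda>i\<in>I. \<Squnion>\<^bsub>Ls i\<^esub> ((\<lambda>x. x i) ` A)) \<in> carrier (product_lattice I Ls)"
      by (simp add: closed)
    show "x \<sqsubseteq>\<^bsub>product_lattice I Ls\<^esub> (\<lambda>i\<in>I. \<Squnion>\<^bsub>Ls i\<^esub> ((\<lambda>x. x i) ` A))" if "x \<in> A" for x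
      using that by (simp add: le_product_lattice upper)
    show "(\<lambda>i\<in>I. \<Squnion>\<^bsub>Ls i\<^esub> ((\<lambda>x. x i) ` A)) \<sqsubseteq>\<^bsub>product_lattice I Ls\<^esub> y"
      if "y \<in> carrier (product_lattice I Ls)" "\<And>x. x \<in> A \<Longrightarrow> x \<sqsubseteq>\<^bsub>product_lattice I Ls\<^esub> y" for y
      using that by (auto simp: le_product_lattice intro!: least dest: PiE_mem)
  qed
qed

lemma top_product_lattice:
  assumes "\<And>i. i \<in> I \<Longrightarrow> complete_lattice (Ls i)"
  shows "\<top>\<^bsub>product_lattice I Ls\<^esub> = (\<lambda>i\<in>I. \<top>\<^bsub>Ls i\<^esub>)"
proof -
  interpret P: complete_lattice "product_lattice I Ls"
    using assms by (intro product_lattice_complete) auto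
  have wbl: "weak_partial_order_top (Ls i)" if "i \<in> I" for i
  proof -
    interpret complete_lattice "Ls i" using assms that by simp
    show ?thesis by unfold_locales
  qed
  show ?thesis
  proof (rule P.le_antisym)
    have "\<top>\<^bsub>product_lattice I Ls\<^esub> i \<in> carrier (Ls i)" if "i \<in> I" for i
      using that P.top_closed by auto
    then show "\<top>\<^bsub>product_lattice I Ls\<^esub> \<sqsubseteq>\<^bsub>product_lattice I Ls\<^esub> (\<lambda>i\<in>I. \<top>\<^bsub>Ls i\<^esub>)"
      by (simp add: le_product_lattice weak_partial_order_top.top_higher[OF wbl])
    show "(\<lambda>i\<in>I. \<top>\<^bsub>Ls i\<^esub>) \<in> carrier (product_lattice I Ls)"
      by (simp add: weak_partial_order_top.top_closed[OF wbl])
    then show "(\<lambda>i\<in>I. \<top>\<^bsub>Ls i\<^esub>) \<sqsubseteq>\<^bsub>product_lattice I Ls\<^esub> \<top>\<^bsub>product_lattice I Ls\<^esub>"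
      by (rule P.top_higher)
  qed (rule P.top_closed)
qed

text \<open>Bottom is the empty supremum, so this is the case \<open>A = {}\<close> of
  \<open>sup_product_lattice\<close>.\<close>

lemma bottom_product_lattice:
  assumes "\<And>i. i \<in> I \<Longrightarrow> complete_lattice (Ls i)"
  shows "\<bottom>\<^bsub>product_lattice I Ls\<^esub> = (\<lambda>i\<in>I. \<bottom>\<^bsub>Ls i\<^esub>)"
proof -
  interpret P: complete_lattice "product_lattice I Ls"
    using assms by (intro product_lattice_complete) auto
  have "\<Squnion>\<^bsub>product_lattice I Ls\<^esub>{} = (\<lambda>i\<in>I. \<Squnion>\<^bsub>Ls i\<^esub>{})"
    using sup_product_lattice[OF assms, where A = "{}"] by simp
  then show ?thesis
    using complete_lattice.sup_empty[OF assms] P.sup_empty by (simp cong: restrict_cong)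
qed

section \<open>Maps preserving suprema\<close>

text \<open>Suprema of subsets of the carrier stay in the carrier, so only values there matter. This
  allows \<open>f\<close> to be replaced by a formula that is known to agree with it on the carrier
  only.\<close>

lemma sup_pres_cong:
  assumes "\<And>x. x \<in> carrier X \<Longrightarrow> f x = g x"
  shows "sup_pres X Y f \<longleftrightarrow> sup_pres X Y g"
proof -
  have "f (\<Squnion>\<^bsub>X\<^esub>A) = g (\<Squnion>\<^bsub>X\<^esub>A)" if "complete_lattice X" "A \<subseteq> carrier X" for A
    using that by (intro assms weak_complete_lattice.sup_closed complete_lattice_weak)
  moreover have "f ` A = g ` A" if "A \<subseteq> carrier X" for A
    using that assms by (intro image_cong) auto
  ultimately show ?thesis by (simp add: sup_pres_def cong: conj_cong)
qed

lemma sup_pres_sup: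
  "sup_pres X Y f \<Longrightarrow> A \<subseteq> carrier X \<Longrightarrow> f (\<Squnion>\<^bsub>X\<^esub>A) = \<Squnion>\<^bsub>Y\<^esub>(f ` A)"
  by (simp add: sup_pres_def)

lemma sup_pres_bottom: "sup_pres X Y f \<Longrightarrow> f \<bottom>\<^bsub>X\<^esub> = \<bottom>\<^bsub>Y\<^esub>"
  using sup_pres_sup[of X Y f "{}"] by (simp add: sup_pres_def complete_lattice.sup_empty)

lemma sup_pres_isotone:
  "sup_pres X Y f \<Longrightarrow> f \<in> carrier X \<rightarrow> carrier Y \<Longrightarrow> isotone X Y f"
  by (intro join_pres_isotone sup_pres_is_join_pres weak_sup_pres)

lemma sup_pres_id: "complete_lattice X \<Longrightarrow> sup_pres X X (\<lambda>x. x)"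
  by (simp add: sup_pres_def)

text \<open>Among constants, bottom is the one compatible with the empty supremum. It occurs as the
  off-diagonal coordinate of \<open>product_embed\<close>.\<close>

lemma sup_pres_const_bottom:
  assumes "complete_lattice X" "complete_lattice Y"
  shows "sup_pres X Y (\<lambda>_. \<bottom>\<^bsub>Y\<^esub>)"
proof -
  interpret Y: complete_lattice Y by fact
  have "\<Squnion>\<^bsub>Y\<^esub>((\<lambda>_. \<bottom>\<^bsub>Y\<^esub>) ` A) = \<bottom>\<^bsub>Y\<^esub>" if "A \<subseteq> carrier X" for A
    by (cases "A = {}") (simp_all add: Y.sup_empty image_constant_conv)
  with assms show ?thesis by (auto simp: sup_pres_def)
qed

lemma sup_pres_comp:
  assumes "sup_pres X Y f" "sup_pres Y Z g" "f \<in> carrier X \<rightarrow> carrier Y"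
  shows "sup_pres X Z (\<lambda>x. g (f x))"
proof -
  have "f ` A \<subseteq> carrier Y" if "A \<subseteq> carrier X" for A using that assms(3) by auto
  then show ?thesis using assms(1,2) by (auto simp: sup_pres_def image_image)
qed

text \<open>By the adjunction, \<open>f\<close> of the supremum of \<open>A\<close> lies below
  \<open>y\<close> iff that supremum lies below \<open>g y\<close>, iff every \<open>x\<close> in
  \<open>A\<close> does, iff every \<open>f x\<close> lies below \<open>y\<close>. Hence it is the
  least upper bound of the image.\<close>

lemma sup_pres_left_adjoint:
  assumes "complete_lattice X" "complete_lattice Y"
    and f: "f \<in> carrier X \<rightarrow> carrier Y" and g: "g \<in> carrier Y \<rightarrow> carrier X"
    and adj: "\<And>x y. x \<in> carrier X \<Longrightarrow> y \<in> carrier Y \<Longrightarrow> f x \<sqsubseteq>\<^bsub>Y\<^esub> y \<longleftrightarrow> x \<sqsubseteq>\<^bsub>X\<^esub> g y"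
  shows "sup_pres X Y f"
proof -
  interpret X: complete_lattice X by fact
  interpret Y: complete_lattice Y by fact
  have "f (\<Squnion>\<^bsub>X\<^esub>A) = \<Squnion>\<^bsub>Y\<^esub>(f ` A)" if A: "A \<subseteq> carrier X" for A
  proof (rule Y.sup_eqI[symmetric])
    have le: "f (\<Squnion>\<^bsub>X\<^esub>A) \<sqsubseteq>\<^bsub>Y\<^esub> y \<longleftrightarrow> (\<forall>x\<in>A. f x \<sqsubseteq>\<^bsub>Y\<^esub> y)" if "y \<in> carrier Y" for y
    proof -
      have "g y \<in> carrier X" using that g by auto
      with that A show ?thesis by (simp add: adj X.sup_le_iff subset_iff)
    qed
    show fA: "f ` A \<subseteq> carrier Y" using A f by auto
    show fs: "f (\<Squnion>\<^bsub>X\<^esub>A) \<in> carrier Y" using A f X.sup_closed by auto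
    show "y \<sqsubseteq>\<^bsub>Y\<^esub> f (\<Squnion>\<^bsub>X\<^esub>A)" if "y \<in> f ` A" for y
      using le[OF fs] fs that by auto
    show "f (\<Squnion>\<^bsub>X\<^esub>A) \<sqsubseteq>\<^bsub>Y\<^esub> y" if "y \<in> carrier Y" "\<And>x. x \<in> f ` A \<Longrightarrow> x \<sqsubseteq>\<^bsub>Y\<^esub> y" for y
      using le that by auto
  qed
  with assms show ?thesis by (simp add: sup_pres_def)
qed

text \<open>Suprema commute: the two iterated suprema have the same upper bounds, namely the
  \<open>y\<close> above all \<open>h k x\<close> with \<open>k\<close> in \<open>K\<close> and
  \<open>x\<close> in \<open>A\<close>.\<close>

lemma sup_pres_pointwise_sup:
  assumes "complete_lattice X" "complete_lattice Y"
    and h: "\<And>k. k \<in> K \<Longrightarrow> h k \<in> carrier X \<rightarrow> carrier Y"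
    and sp: "\<And>k. k \<in> K \<Longrightarrow> sup_pres X Y (h k)"
  shows "sup_pres X Y (\<lambda>x. \<Squnion>\<^bsub>Y\<^esub>((\<lambda>k. h k x) ` K))"
proof -
  interpret X: complete_lattice X by fact
  interpret Y: complete_lattice Y by fact
  have hc: "h k x \<in> carrier Y" if "k \<in> K" "x \<in> carrier X" for k x
    using h that by auto
  then have hK: "(\<lambda>k. h k x) ` K \<subseteq> carrier Y" if "x \<in> carrier X" for x
    using that by auto
  have "\<Squnion>\<^bsub>Y\<^esub>((\<lambda>k. h k (\<Squnion>\<^bsub>X\<^esub>A)) ` K) = \<Squnion>\<^bsub>Y\<^esub>((\<lambda>x. \<Squnion>\<^bsub>Y\<^esub>((\<lambda>k. h k x) ` K)) ` A)"
    if A: "A \<subseteq> carrier X" for A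
  proof -
    let ?S = "(\<lambda>x. \<Squnion>\<^bsub>Y\<^esub>((\<lambda>k. h k x) ` K)) ` A" and ?T = "(\<lambda>k. h k (\<Squnion>\<^bsub>X\<^esub>A)) ` K"
    have S: "?S \<subseteq> carrier Y"
      using A by (auto intro!: Y.sup_closed hK)
    have T: "?T \<subseteq> carrier Y" using A hK[of "\<Squnion>\<^bsub>X\<^esub>A"] by simp
    have le: "\<Squnion>\<^bsub>Y\<^esub>?T \<sqsubseteq>\<^bsub>Y\<^esub> y \<longleftrightarrow> \<Squnion>\<^bsub>Y\<^esub>?S \<sqsubseteq>\<^bsub>Y\<^esub> y" if y: "y \<in> carrier Y" for y
    proof -
      have "h k ` A \<subseteq> carrier Y" if "k \<in> K" for k using A hc that by auto
      then have "\<Squnion>\<^bsub>Y\<^esub>?T \<sqsubseteq>\<^bsub>Y\<^esub> y \<longleftrightarrow> (\<forall>k\<in>K. \<forall>x\<in>A. h k x \<sqsubseteq>\<^bsub>Y\<^esub> y)"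
        using T y A by (simp add: Y.sup_le_iff sup_pres_sup[OF sp])
      also have "\<dots> \<longleftrightarrow> \<Squnion>\<^bsub>Y\<^esub>?S \<sqsubseteq>\<^bsub>Y\<^esub> y"
        using y A by (auto simp: Y.sup_le_iff[OF S y] Y.sup_le_iff[OF hK y] subsetD)
      finally show ?thesis .
    qed
    have closed: "\<Squnion>\<^bsub>Y\<^esub>?S \<in> carrier Y" "\<Squnion>\<^bsub>Y\<^esub>?T \<in> carrier Y"
      using S T by simp_all
    \<comment> \<open>Taking each supremum in turn for \<open>y\<close> yields the two
      inequalities.\<close>
    with le[OF closed(1)] le[OF closed(2)] show ?thesis by (intro Y.le_antisym) auto
  qed
  with assms show ?thesis by (simp add: sup_pres_def)
qed

lemma sup_pres_product_proj:
  assumes "\<And>i. i \<in> I \<Longrightarrow> complete_lattice (Ls i)" "i \<in> I"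
  shows "sup_pres (product_lattice I Ls) (Ls i) (\<lambda>x. x i)"
proof -
  have "complete_lattice (product_lattice I Ls)" by (rule product_lattice_complete) fact
  with assms(1)[OF assms(2)] show ?thesis
    using assms(2) by (simp add: sup_pres_def sup_product_lattice[OF assms(1)])
qed

lemma sup_pres_into_product:
  assumes "complete_lattice X" "\<And>i. i \<in> I \<Longrightarrow> complete_lattice (Ls i)"
    and h: "h \<in> carrier X \<rightarrow> carrier (product_lattice I Ls)"
    and sp: "\<And>i. i \<in> I \<Longrightarrow> sup_pres X (Ls i) (\<lambda>x. h x i)"
  shows "sup_pres X (product_lattice I Ls) h"
proof -
  interpret X: complete_lattice X by fact
  have "h (\<Squnion>\<^bsub>X\<^esub>A) = \<Squnion>\<^bsub>product_lattice I Ls\<^esub>(h ` A)" if A: "A \<subseteq> carrier X" for A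
  proof -
    have "h ` A \<subseteq> carrier (product_lattice I Ls)" using A h by blast
    then have "\<Squnion>\<^bsub>product_lattice I Ls\<^esub>(h ` A) = (\<lambda>i\<in>I. \<Squnion>\<^bsub>Ls i\<^esub>((\<lambda>x. h x i) ` A))"
      using assms(2) by (subst sup_product_lattice) (auto simp: image_image)
    also have "\<dots> = (\<lambda>i\<in>I. h (\<Squnion>\<^bsub>X\<^esub>A) i)"
      using sp A by (intro restrict_ext) (simp add: sup_pres_sup[OF sp])
    also have "\<dots> = h (\<Squnion>\<^bsub>X\<^esub>A)"
      using funcset_mem[OF h X.sup_closed[OF A]] by (simp add: PiE_restrict)
    finally show ?thesis ..
  qed
  then show ?thesis
    using assms(1) product_lattice_complete[of I Ls] assms(2) by (simp add: sup_pres_def)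
qed

section \<open>Embedding a factor into a product\<close>

definition product_embed :: "'i set \<Rightarrow> ('i \<Rightarrow> 'a gorder) \<Rightarrow> 'i \<Rightarrow> 'a \<Rightarrow> ('i \<Rightarrow> 'a)" where
  "product_embed I Ls i a = (\<lambda>k\<in>I. if k = i then a else \<bottom>\<^bsub>Ls k\<^esub>)"

lemma complete_lattice_bottom_closed: "complete_lattice L \<Longrightarrow> \<bottom>\<^bsub>L\<^esub> \<in> carrier L"
  using weak_complete_lattice.sup_closed[OF complete_lattice_weak, of L "{}"]
  by (simp add: complete_lattice.sup_empty)

lemma product_embed_closed:
  assumes "\<And>i. i \<in> I \<Longrightarrow> complete_lattice (Ls i)"
  shows "product_embed I Ls i \<in> carrier (Ls i) \<rightarrow> carrier (product_lattice I Ls)"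
  by (auto simp: product_embed_def assms complete_lattice_bottom_closed)

text \<open>Each coordinate of the embedding is either the identity (at \<open>i\<close>) or
  constantly bottom.\<close>

lemma product_embed_sup_pres:
  assumes Ls: "\<And>i. i \<in> I \<Longrightarrow> complete_lattice (Ls i)" and i: "i \<in> I"
  shows "sup_pres (Ls i) (product_lattice I Ls) (product_embed I Ls i)"
proof (rule sup_pres_into_product)
  show "sup_pres (Ls i) (Ls k) (\<lambda>a. product_embed I Ls i a k)" if "k \<in> I" for k
    using that i Ls by (cases "k = i")
      (simp_all add: product_embed_def sup_pres_id sup_pres_const_bottom)
  show "product_embed I Ls i \<in> carrier (Ls i) \<rightarrow> carrier (product_lattice I Ls)"
    using Ls by (rule product_embed_closed)
qed (use assms in auto)

text \<open>At coordinate \<open>k\<close> the embedding with \<open>i = k\<close> contributes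
  \<open>x k\<close> and all others contribute bottom. The lemma serves both for the product of the
  factors and for the power of \<open>L\<close>.\<close>

lemma sup_product_embed:
  assumes Ls: "\<And>i. i \<in> I \<Longrightarrow> complete_lattice (Ls i)" and x: "x \<in> carrier (product_lattice I Ls)"
  shows "\<Squnion>\<^bsub>product_lattice I Ls\<^esub>((\<lambda>i. product_embed I Ls i (x i)) ` I) = x"
proof -
  have xi: "x i \<in> carrier (Ls i)" if "i \<in> I" for i
    using x that by auto
  have "(\<lambda>i. product_embed I Ls i (x i)) ` I \<subseteq> carrier (product_lattice I Ls)"
    by (auto intro!: funcset_mem[OF product_embed_closed[OF Ls]] xi simp del: carrier_product_lattice)
  then have "\<Squnion>\<^bsub>product_lattice I Ls\<^esub>((\<lambda>i. product_embed I Ls i (x i)) ` I)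
      = (\<lambda>k\<in>I. \<Squnion>\<^bsub>Ls k\<^esub>((\<lambda>i. product_embed I Ls i (x i) k) ` I))"
    using Ls by (simp add: sup_product_lattice image_image)
  also have "\<dots> = (\<lambda>k\<in>I. x k)"
  proof (rule restrict_ext)
    fix k assume k: "k \<in> I"
    interpret complete_lattice "Ls k" using Ls k .
    show "\<Squnion>\<^bsub>Ls k\<^esub>((\<lambda>i. product_embed I Ls i (x i) k) ` I) = x k"
    proof (rule sup_eqI)
      have k_in: "x k \<in> (\<lambda>i. product_embed I Ls i (x i) k) ` I"
        using k by (intro image_eqI[where x = k]) (simp_all add: product_embed_def)
      show "x k \<sqsubseteq>\<^bsub>Ls k\<^esub> y"
        if "\<And>z. z \<in> (\<lambda>i. product_embed I Ls i (x i) k) ` I \<Longrightarrow> z \<sqsubseteq>\<^bsub>Ls k\<^esub> y" for y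
        using that k_in by simp
      show "z \<sqsubseteq>\<^bsub>Ls k\<^esub> x k" if "z \<in> (\<lambda>i. product_embed I Ls i (x i) k) ` I" for z
        using that k xi by (auto simp: product_embed_def)
      show "(\<lambda>i. product_embed I Ls i (x i) k) ` I \<subseteq> carrier (Ls k)"
        using k xi by (auto simp: product_embed_def)
    qed (use k xi in simp)
  qed
  also have "\<dots> = x" using x by (simp add: PiE_restrict)
  finally show ?thesis .
qed

section \<open>Subdirect products\<close>

lemma system_map_closed:
  assumes "\<And>i. i \<in> I \<Longrightarrow> complete_lattice (Ls i)"
    and "\<And>i j. i \<in> I \<Longrightarrow> j \<in> I \<Longrightarrow> g i j \<in> carrier (Ls i) \<rightarrow> carrier (Ls j)"
  shows "system_map I Ls g \<in> carrier (product_lattice I Ls) \<rightarrow> carrier (product_lattice I Ls)"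
proof
  fix z assume z: "z \<in> carrier (product_lattice I Ls)"
  have "(\<lambda>i. g i j (z i)) ` I \<subseteq> carrier (Ls j)" if "j \<in> I" for j
    using that z assms(2) by fastforce
  then show "system_map I Ls g z \<in> carrier (product_lattice I Ls)"
    by (simp add: system_map_def assms(1) complete_lattice_weak weak_complete_lattice.sup_closed)
qed

text \<open>Coordinate \<open>j\<close> is a pointwise supremum of composites of a projection with
  \<open>g i j\<close>, all of which preserve suprema.\<close>

lemma system_map_sup_pres:
  assumes Ls: "\<And>i. i \<in> I \<Longrightarrow> complete_lattice (Ls i)"
    and g: "\<And>i j. i \<in> I \<Longrightarrow> j \<in> I \<Longrightarrow> g i j \<in> carrier (Ls i) \<rightarrow> carrier (Ls j)"
    and sp: "\<And>i j. i \<in> I \<Longrightarrow> j \<in> I \<Longrightarrow> sup_pres (Ls i) (Ls j) (g i j)"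
  shows "sup_pres (product_lattice I Ls) (product_lattice I Ls) (system_map I Ls g)"
proof (rule sup_pres_into_product)
  fix j assume j: "j \<in> I"
  have "sup_pres (product_lattice I Ls) (Ls j) (\<lambda>z. \<Squnion>\<^bsub>Ls j\<^esub>((\<lambda>i. g i j (z i)) ` I))"
  proof (rule sup_pres_pointwise_sup)
    fix i assume i: "i \<in> I"
    show "sup_pres (product_lattice I Ls) (Ls j) (\<lambda>z. g i j (z i))"
      by (rule sup_pres_comp[OF sup_pres_product_proj[of I Ls, OF Ls i] sp[OF i j]]) (use i in auto)
    show "(\<lambda>z. g i j (z i)) \<in> carrier (product_lattice I Ls) \<rightarrow> carrier (Ls j)"
      using g[OF i j] i by (auto dest!: funcset_mem)
  next
    show "complete_lattice (product_lattice I Ls)" using Ls by (rule product_lattice_complete)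
  qed (rule Ls[OF j])
  then show "sup_pres (product_lattice I Ls) (Ls j) (\<lambda>z. system_map I Ls g z j)"
    using j by (simp add: system_map_def)
next
  show "complete_lattice (product_lattice I Ls)" using Ls by (rule product_lattice_complete)
  show "system_map I Ls g \<in> carrier (product_lattice I Ls) \<rightarrow> carrier (product_lattice I Ls)"
    using Ls g by (rule system_map_closed)
qed (rule Ls)

section \<open>Order, bounds and suprema inherited from the product\<close>

locale finite_subdirect_product =
  fixes I :: "'i set" and Ls :: "'i \<Rightarrow> 'a gorder" and L :: "('i \<Rightarrow> 'a) gorder"
  assumes finite_factor: "i \<in> I \<Longrightarrow> finite_lattice (Ls i)"
    and finite_lattice_L: "finite_lattice L"
    and subdirect: "subdirect_product L I Ls"
begin

abbreviation P where "P \<equiv> product_lattice I Ls"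
abbreviation cl where "cl \<equiv> closure_op P L"

lemma factor_complete: "i \<in> I \<Longrightarrow> complete_lattice (Ls i)"
  by (simp add: finite_factor finite_lattice_complete)

lemma L_complete: "complete_lattice L"
  by (simp add: finite_lattice_L finite_lattice_complete)

lemma P_complete: "complete_lattice P"
  using factor_complete by (rule product_lattice_complete)

interpretation L: complete_lattice L by (rule L_complete)
interpretation P: complete_lattice P by (rule P_complete)

lemma carrier_subset: "carrier L \<subseteq> carrier P"
  using subdirect by (simp add: subdirect_product_def sublattice_def)

lemma join_eq: "x \<in> carrier L \<Longrightarrow> y \<in> carrier L \<Longrightarrow> x \<squnion>\<^bsub>L\<^esub> y = x \<squnion>\<^bsub>P\<^esub> y"
  using subdirect by (simp add: subdirect_product_def sublattice_def)

lemma meet_eq: "x \<in> carrier L \<Longrightarrow> y \<in> carrier L \<Longrightarrow> x \<sqinter>\<^bsub>L\<^esub> y = x \<sqinter>\<^bsub>P\<^esub> y"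
  using subdirect by (simp add: subdirect_product_def sublattice_def)

lemma le_eq:
  assumes "x \<in> carrier L" "y \<in> carrier L"
  shows "x \<sqsubseteq>\<^bsub>L\<^esub> y \<longleftrightarrow> x \<sqsubseteq>\<^bsub>P\<^esub> y"
proof -
  have P: "x \<in> carrier P" "y \<in> carrier P" using assms carrier_subset by auto
  show ?thesis
    \<comment> \<open>Despite its name, \<open>le_iff_meet\<close> expresses the order through the
      join; this is why \<open>join_eq\<close> finishes the proof.\<close>
    unfolding L.le_iff_meet[OF assms] P.le_iff_meet[OF P] join_eq[OF assms] ..
qed

lemma ex_coordinate:
  assumes "i \<in> I" "a \<in> carrier (Ls i)"
  obtains u where "u \<in> carrier L" "u i = a"
proof -
  have "a \<in> (\<lambda>x. x i) ` carrier L" using subdirect assms by (simp add: subdirect_product_def)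
  then show thesis using that by auto
qed

text \<open>A sublattice need not share the bounds; surjectivity of the projections forces it. For
  each \<open>i\<close> some \<open>u\<close> in \<open>L\<close>, depending on \<open>i\<close>,
  has the bottom of the factor as its \<open>i\<close>-th component, and the bottom of
  \<open>L\<close> lies below \<open>u\<close>.\<close>

lemma bottom_eq: "\<bottom>\<^bsub>L\<^esub> = \<bottom>\<^bsub>P\<^esub>"
proof (rule P.le_antisym)
  show "\<bottom>\<^bsub>L\<^esub> \<in> carrier P" using carrier_subset L.bottom_closed by blast
  then show "\<bottom>\<^bsub>P\<^esub> \<sqsubseteq>\<^bsub>P\<^esub> \<bottom>\<^bsub>L\<^esub>" by (rule P.bottom_lower)
  let ?y = "\<bottom>\<^bsub>P\<^esub>"
  show y: "?y \<in> carrier P" by (rule P.bottom_closed)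
  show "\<bottom>\<^bsub>L\<^esub> \<sqsubseteq>\<^bsub>P\<^esub> ?y"
    unfolding le_product_lattice
  proof
    fix i assume i: "i \<in> I"
    with y have "?y i \<in> carrier (Ls i)" by auto
    with i obtain u where u: "u \<in> carrier L" "u i = ?y i" by (rule ex_coordinate)
    then have "\<bottom>\<^bsub>L\<^esub> \<sqsubseteq>\<^bsub>P\<^esub> u" using le_eq[of "\<bottom>\<^bsub>L\<^esub>" u] by simp
    with i u(2) show "\<bottom>\<^bsub>L\<^esub> i \<sqsubseteq>\<^bsub>Ls i\<^esub> ?y i" by (auto simp: le_product_lattice)
  qed
qed

text \<open>Dual to \<open>bottom_eq\<close>, again with one witness per coordinate.\<close>

lemma top_eq: "\<top>\<^bsub>L\<^esub> = \<top>\<^bsub>P\<^esub>"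
proof (rule P.le_antisym)
  show "\<top>\<^bsub>L\<^esub> \<in> carrier P" using carrier_subset L.top_closed by blast
  then show "\<top>\<^bsub>L\<^esub> \<sqsubseteq>\<^bsub>P\<^esub> \<top>\<^bsub>P\<^esub>" by (rule P.top_higher)
  let ?y = "\<top>\<^bsub>P\<^esub>"
  show y: "?y \<in> carrier P" by (rule P.top_closed)
  show "?y \<sqsubseteq>\<^bsub>P\<^esub> \<top>\<^bsub>L\<^esub>"
    unfolding le_product_lattice
  proof
    fix i assume i: "i \<in> I"
    with y have "?y i \<in> carrier (Ls i)" by auto
    with i obtain u where u: "u \<in> carrier L" "u i = ?y i" by (rule ex_coordinate)
    then have "u \<sqsubseteq>\<^bsub>P\<^esub> \<top>\<^bsub>L\<^esub>" using le_eq[of u "\<top>\<^bsub>L\<^esub>"] by simp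
    with i u(2) show "?y i \<sqsubseteq>\<^bsub>Ls i\<^esub> \<top>\<^bsub>L\<^esub> i" by (auto simp: le_product_lattice)
  qed
qed

lemma finite_subset_L: "A \<subseteq> carrier L \<Longrightarrow> finite A"
  using finite_lattice_L by (auto simp: finite_lattice_def intro: finite_subset)

text \<open>Induction over the finite set: the empty case is the shared bottom, the insertion step
  the shared binary join.\<close>

lemma sup_eq: "A \<subseteq> carrier L \<Longrightarrow> \<Squnion>\<^bsub>L\<^esub>A = \<Squnion>\<^bsub>P\<^esub>A"
proof -
  assume "A \<subseteq> carrier L"
  with finite_subset_L[OF this] show ?thesis
  proof (induction A)
    case empty
    show ?case by (simp only: L.sup_empty P.sup_empty bottom_eq)
  next
    case (insert a A)
    then have A: "a \<in> carrier L" "A \<subseteq> carrier L" by auto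
    then have "a \<in> carrier P" "A \<subseteq> carrier P" using carrier_subset by auto
    then have "\<Squnion>\<^bsub>P\<^esub>insert a A = a \<squnion>\<^bsub>P\<^esub> \<Squnion>\<^bsub>P\<^esub>A" by (rule P.sup_insert)
    also have "\<dots> = a \<squnion>\<^bsub>L\<^esub> \<Squnion>\<^bsub>L\<^esub>A"
      using A by (simp add: join_eq L.sup_closed flip: insert.IH)
    also have "\<dots> = \<Squnion>\<^bsub>L\<^esub>insert a A" using A by (rule L.sup_insert[symmetric])
    finally show ?case ..
  qed
qed

text \<open>Dual to \<open>sup_eq\<close>. It ensures that the closure, an infimum taken in the
  product, has its values in \<open>L\<close>.\<close>

lemma inf_eq: "A \<subseteq> carrier L \<Longrightarrow> \<Sqinter>\<^bsub>L\<^esub>A = \<Sqinter>\<^bsub>P\<^esub>A"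
proof -
  assume "A \<subseteq> carrier L"
  with finite_subset_L[OF this] show ?thesis
  proof (induction A)
    case empty
    show ?case by (simp only: L.inf_empty P.inf_empty top_eq)
  next
    case (insert a A)
    then have A: "a \<in> carrier L" "A \<subseteq> carrier L" by auto
    then have "a \<in> carrier P" "A \<subseteq> carrier P" using carrier_subset by auto
    then have "\<Sqinter>\<^bsub>P\<^esub>insert a A = a \<sqinter>\<^bsub>P\<^esub> \<Sqinter>\<^bsub>P\<^esub>A" by (rule P.inf_insert)
    also have "\<dots> = a \<sqinter>\<^bsub>L\<^esub> \<Sqinter>\<^bsub>L\<^esub>A"
      using A by (simp add: meet_eq L.inf_closed flip: insert.IH)
    also have "\<dots> = \<Sqinter>\<^bsub>L\<^esub>insert a A" using A by (rule L.inf_insert[symmetric])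
    finally show ?case ..
  qed
qed

lemma inclusion_sup_pres: "sup_pres L P (\<lambda>x. x)"
  using L_complete P_complete sup_eq by (simp add: sup_pres_def)

lemma coordinate_closed: "i \<in> I \<Longrightarrow> (\<lambda>x. x i) \<in> carrier L \<rightarrow> carrier (Ls i)"
  using carrier_subset by auto

lemma coordinate_sup_pres: "i \<in> I \<Longrightarrow> sup_pres L (Ls i) (\<lambda>x. x i)"
  using carrier_subset
  by (intro sup_pres_comp[OF inclusion_sup_pres sup_pres_product_proj]) (auto intro: factor_complete)

section \<open>The closure operator and the left adjoints of the projections\<close>

lemma closure_closed: "cl \<in> carrier P \<rightarrow> carrier L"
proof
  fix z
  have "{u \<in> carrier L. z \<sqsubseteq>\<^bsub>P\<^esub> u} \<subseteq> carrier L" by auto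
  then show "cl z \<in> carrier L" unfolding closure_op_def by (metis inf_eq L.inf_closed)
qed

text \<open>\<open>z\<close> is a lower bound of the set whose infimum is \<open>cl z\<close>, hence
  lies below \<open>cl z\<close>; conversely, an element \<open>u\<close> of \<open>L\<close> above
  \<open>z\<close> belongs to that set.\<close>

lemma closure_adjoint:
  assumes z: "z \<in> carrier P" and u: "u \<in> carrier L"
  shows "cl z \<sqsubseteq>\<^bsub>L\<^esub> u \<longleftrightarrow> z \<sqsubseteq>\<^bsub>P\<^esub> u"
proof -
  let ?U = "{u \<in> carrier L. z \<sqsubseteq>\<^bsub>P\<^esub> u}"
  have U: "?U \<subseteq> carrier P" using carrier_subset by auto
  have c: "cl z \<in> carrier L" using closure_closed z by (rule funcset_mem)
  then have cP: "cl z \<in> carrier P" and uP: "u \<in> carrier P" using carrier_subset u by auto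
  have le: "z \<sqsubseteq>\<^bsub>P\<^esub> cl z"
    unfolding closure_op_def using U z by (intro P.inf_greatest) auto
  show ?thesis
  proof
    assume "cl z \<sqsubseteq>\<^bsub>L\<^esub> u"
    with le_eq[OF c u] le show "z \<sqsubseteq>\<^bsub>P\<^esub> u" using P.le_trans z cP uP by blast
  next
    assume "z \<sqsubseteq>\<^bsub>P\<^esub> u"
    with u have "cl z \<sqsubseteq>\<^bsub>P\<^esub> u" unfolding closure_op_def using U by (intro P.inf_lower) auto
    with le_eq[OF c u] show "cl z \<sqsubseteq>\<^bsub>L\<^esub> u" by simp
  qed
qed

lemma closure_sup_pres: "sup_pres P L cl"
proof (rule sup_pres_left_adjoint[OF P_complete L_complete closure_closed, where g = "\<lambda>u. u"])
  show "(\<lambda>u. u) \<in> carrier L \<rightarrow> carrier P" using carrier_subset by blast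
qed (rule closure_adjoint)

text \<open>Both inequalities are instances of the adjunction, at \<open>u = x\<close> and at
  \<open>u = cl x\<close>.\<close>

lemma closure_fixed:
  assumes "x \<in> carrier L"
  shows "cl x = x"
proof (rule L.le_antisym)
  have xP: "x \<in> carrier P" using assms carrier_subset by auto
  then show c: "cl x \<in> carrier L" by (rule funcset_mem[OF closure_closed])
  show "cl x \<sqsubseteq>\<^bsub>L\<^esub> x" using closure_adjoint[OF xP assms] xP by simp
  show "x \<sqsubseteq>\<^bsub>L\<^esub> cl x" using closure_adjoint[OF xP c] le_eq[OF assms c] c by simp
qed (rule assms)

lemma closure_embed_closed:
  "i \<in> I \<Longrightarrow> (\<lambda>a. cl (product_embed I Ls i a)) \<in> carrier (Ls i) \<rightarrow> carrier L"
  by (intro funcsetI funcset_mem[OF closure_closed]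
      funcset_mem[OF product_embed_closed[OF factor_complete]])

text \<open>The map \<open>a \<mapsto> cl (product_embed I Ls i a)\<close> is the left adjoint \<open>m\<^sub>i\<close> of the projection.\<close>

lemma closure_embed_sup_pres:
  "i \<in> I \<Longrightarrow> sup_pres (Ls i) L (\<lambda>a. cl (product_embed I Ls i a))"
  by (rule sup_pres_comp[OF product_embed_sup_pres closure_sup_pres product_embed_closed])
    (auto intro: factor_complete)

text \<open>Applying \<open>cl\<close> to the decomposition of \<open>x\<close> in the product turns
  the supremum there into one in \<open>L\<close> and leaves \<open>x\<close> fixed.\<close>

lemma sup_closure_embed:
  assumes "x \<in> carrier L"
  shows "\<Squnion>\<^bsub>L\<^esub>((\<lambda>i. cl (product_embed I Ls i (x i))) ` I) = x"
proof -
  have x: "x \<in> carrier P" using assms carrier_subset by auto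
  then have "x i \<in> carrier (Ls i)" if "i \<in> I" for i using that by auto
  then have "(\<lambda>i. product_embed I Ls i (x i)) ` I \<subseteq> carrier P"
    by (intro image_subsetI funcset_mem[OF product_embed_closed[OF factor_complete]])
  from sup_pres_sup[OF closure_sup_pres this] show ?thesis
    using sup_product_embed[OF factor_complete x] closure_fixed[OF assms] by (simp add: image_image)
qed

text \<open>\<open>F\<close> is applied to the decomposition of \<open>x\<close> from
  \<open>sup_closure_embed\<close>. The resulting supremum in \<open>L\<close> is also one in the
  product, hence is computed coordinatewise, which is exactly what \<open>system_map\<close>
  does.\<close>

lemma system_map_sup_pres_L:
  assumes F: "F \<in> carrier L \<rightarrow> carrier L" and sp: "sup_pres L L F" and x: "x \<in> carrier L"
  shows "system_map I Ls (\<lambda>i j a. F (cl (product_embed I Ls i a)) j) x = F x"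
proof -
  let ?m = "\<lambda>i. cl (product_embed I Ls i (x i))"
  have m: "?m ` I \<subseteq> carrier L"
    by (intro image_subsetI funcset_mem[OF closure_embed_closed] funcset_mem[OF coordinate_closed] x)
  then have Fm: "(\<lambda>i. F (?m i)) ` I \<subseteq> carrier L"
    by (auto intro!: funcset_mem[OF F])
  have "F x = F (\<Squnion>\<^bsub>L\<^esub>(?m ` I))" using sup_closure_embed[OF x] by simp
  also have "\<dots> = \<Squnion>\<^bsub>P\<^esub>((\<lambda>i. F (?m i)) ` I)"
    using sup_pres_sup[OF sp m] sup_eq[OF Fm] by (simp add: image_image)
  also have "\<dots> = system_map I Ls (\<lambda>i j a. F (cl (product_embed I Ls i a)) j) x"
    using sup_product_lattice[OF factor_complete, where A = "(\<lambda>i. F (?m i)) ` I"] Fm carrier_subset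
    by (simp add: system_map_def image_image)
  finally show ?thesis ..
qed

end

theorem theorem2:
  fixes I :: "'i set"
    and Ls :: "'i \<Rightarrow> 'a gorder"
    and L :: "('i \<Rightarrow> 'a) gorder"
    and n :: nat
    and f :: "(nat \<Rightarrow> ('i \<Rightarrow> 'a)) \<Rightarrow> ('i \<Rightarrow> 'a)"
  assumes "finite I"
    and "\<And>i. i \<in> I \<Longrightarrow> finite_lattice (Ls i)"
    and "finite_lattice L"
    and "subdirect_product L I Ls"
    and "n \<ge> 1"
    and "f \<in> carrier (power_lattice L n) \<rightarrow> carrier L"
  shows "(aggregation_function n L f \<and> sup_pres (power_lattice L n) L f) \<longleftrightarrow>
    (\<exists>g :: nat \<Rightarrow> 'i \<Rightarrow> 'i \<Rightarrow> 'a \<Rightarrow> 'a.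
      (\<forall>l\<in>{1..n}. \<forall>i\<in>I. \<forall>j\<in>I.
        g l i j \<in> carrier (Ls i) \<rightarrow> carrier (Ls j) \<and> sup_pres (Ls i) (Ls j) (g l i j)) \<and>
      (\<forall>j\<in>I.
        \<Squnion>\<^bsub>Ls j\<^esub> ((\<lambda>l. \<Squnion>\<^bsub>Ls j\<^esub> ((\<lambda>i. g l i j \<top>\<^bsub>Ls i\<^esub>) ` I)) ` {1..n}) = \<top>\<^bsub>Ls j\<^esub>) \<and>
      (\<forall>x\<in>carrier (power_lattice L n).
        f x = \<Squnion>\<^bsub>L\<^esub> ((\<lambda>l. closure_op (product_lattice I Ls) L (system_map I Ls (g l) (x l))) ` {1..n})))"
proof
  interpret finite_subdirect_product I Ls L using assms(2-4) by unfold_locales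
  interpret L: complete_lattice L by (rule L_complete)
  interpret P: complete_lattice P by (rule P_complete)
  let ?N = "{1..n}"
  let ?Q = "power_lattice L n"
  have Q: "?Q = product_lattice ?N (\<lambda>_. L)" by (simp add: power_lattice_def)
  have Q_complete: "complete_lattice ?Q"
    unfolding Q using L_complete by (rule product_lattice_complete)
  have Q_coord: "x l \<in> carrier L" if "x \<in> carrier ?Q" "l \<in> ?N" for x l
    using that by (auto simp: Q)
  have Q_top: "\<top>\<^bsub>?Q\<^esub> = (\<lambda>l\<in>?N. \<top>\<^bsub>L\<^esub>)"
    unfolding Q using L_complete by (rule top_product_lattice)
  have Q_bottom: "\<bottom>\<^bsub>?Q\<^esub> = (\<lambda>l\<in>?N. \<bottom>\<^bsub>L\<^esub>)"
    unfolding Q using L_complete by (rule bottom_product_lattice)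
  \<comment> \<open>This links the condition on the tops of the factors with the value of
    \<open>f\<close> at the top tuple.\<close>
  have top_coord: "\<top>\<^bsub>L\<^esub> j = \<top>\<^bsub>Ls j\<^esub>" if "j \<in> I" for j
    using that top_eq top_product_lattice[of I Ls, OF factor_complete] by simp
  {
    assume "aggregation_function n L f \<and> sup_pres ?Q L f"
    then have sp: "sup_pres ?Q L f" and f_top: "f (\<lambda>l\<in>?N. \<top>\<^bsub>L\<^esub>) = \<top>\<^bsub>L\<^esub>"
      by (auto simp: aggregation_function_def)
    \<comment> \<open>\<open>F l\<close> is \<open>f\<^sub>l\<close> of the overview,
      \<open>cl (product_embed I Ls i a)\<close> is \<open>m\<^sub>i a\<close>, and
      \<open>g l i j\<close> is \<open>f\<^sup>l\<^sub>i\<^sub>j\<close>.\<close>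
    define F where "F l a = f (product_embed ?N (\<lambda>_. L) l a)" for l a
    define g where "g l i j a = F l (cl (product_embed I Ls i a)) j" for l i j a
    have embed: "product_embed ?N (\<lambda>_. L) l \<in> carrier L \<rightarrow> carrier ?Q" for l
      unfolding Q using product_embed_closed[of ?N "\<lambda>_. L"] L_complete by blast
    have F_closed: "F l \<in> carrier L \<rightarrow> carrier L" for l
      unfolding F_def by (intro funcsetI funcset_mem[OF assms(6)] funcset_mem[OF embed])
    have F_sp: "sup_pres L L (F l)" if "l \<in> ?N" for l
      unfolding F_def using that product_embed_sup_pres[of ?N "\<lambda>_. L"] L_complete
      by (intro sup_pres_comp[OF _ sp embed]) (simp add: Q)
    have system: "system_map I Ls (g l) x = F l x" if "l \<in> ?N" "x \<in> carrier L" for l x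
      unfolding g_def using F_closed F_sp that by (intro system_map_sup_pres_L) auto
    have f_eq: "f x = \<Squnion>\<^bsub>L\<^esub>((\<lambda>l. F l (x l)) ` ?N)" if x: "x \<in> carrier ?Q" for x
    proof -
      let ?A = "(\<lambda>l. product_embed ?N (\<lambda>_. L) l (x l)) ` ?N"
      have "?A \<subseteq> carrier ?Q"
        by (intro image_subsetI funcset_mem[OF embed] Q_coord[OF x])
      note sup_A = sup_pres_sup[OF sp this]
      \<comment> \<open>The decomposition lemma for the constant family \<open>L\<close> over
        \<open>?N\<close> splits a tuple into its single-entry parts.\<close>
      have "f x = f (\<Squnion>\<^bsub>?Q\<^esub>?A)"
        using sup_product_embed[of ?N "\<lambda>_. L"] L_complete x by (simp add: Q)
      also have "\<dots> = \<Squnion>\<^bsub>L\<^esub>((\<lambda>l. F l (x l)) ` ?N)"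
        unfolding sup_A by (simp add: F_def image_image)
      finally show ?thesis .
    qed
    have "g l i j \<in> carrier (Ls i) \<rightarrow> carrier (Ls j)" "sup_pres (Ls i) (Ls j) (g l i j)"
      if l: "l \<in> ?N" and i: "i \<in> I" and j: "j \<in> I" for l i j
    proof -
      have FM: "(\<lambda>a. F l (cl (product_embed I Ls i a))) \<in> carrier (Ls i) \<rightarrow> carrier L"
        by (intro funcsetI funcset_mem[OF F_closed] funcset_mem[OF closure_embed_closed[OF i]])
      then show "g l i j \<in> carrier (Ls i) \<rightarrow> carrier (Ls j)"
        unfolding g_def by (auto intro!: funcset_mem[OF coordinate_closed[OF j]] dest!: funcset_mem)
      have "sup_pres (Ls i) L (\<lambda>a. F l (cl (product_embed I Ls i a)))"
        by (rule sup_pres_comp[OF closure_embed_sup_pres[OF i] F_sp[OF l] closure_embed_closed[OF i]])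
      from sup_pres_comp[OF this coordinate_sup_pres[OF j] FM]
      show "sup_pres (Ls i) (Ls j) (g l i j)" by (simp add: g_def[abs_def])
    qed
    \<comment> \<open>At the top of \<open>L\<close>, \<open>system\<close> identifies the inner
      supremum with component \<open>j\<close> of \<open>F l\<close> there. The outer supremum is
      then component \<open>j\<close> of \<open>f\<close> at the top tuple, which is the top of
      \<open>L\<close>.\<close>
    moreover have "\<Squnion>\<^bsub>Ls j\<^esub>((\<lambda>l. \<Squnion>\<^bsub>Ls j\<^esub>((\<lambda>i. g l i j \<top>\<^bsub>Ls i\<^esub>) ` I)) ` ?N) = \<top>\<^bsub>Ls j\<^esub>"
      if j: "j \<in> I" for j
    proof -
      have "\<Squnion>\<^bsub>Ls j\<^esub>((\<lambda>i. g l i j \<top>\<^bsub>Ls i\<^esub>) ` I) = F l \<top>\<^bsub>L\<^esub> j" if "l \<in> ?N" for l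
        using system[OF that L.top_closed, symmetric] j
        by (simp add: system_map_def top_coord cong: image_cong_simp)
      then have "\<Squnion>\<^bsub>Ls j\<^esub>((\<lambda>l. \<Squnion>\<^bsub>Ls j\<^esub>((\<lambda>i. g l i j \<top>\<^bsub>Ls i\<^esub>) ` I)) ` ?N)
          = \<Squnion>\<^bsub>Ls j\<^esub>((\<lambda>x. x j) ` (\<lambda>l. F l \<top>\<^bsub>L\<^esub>) ` ?N)"
        by (simp add: image_image cong: image_cong_simp)
      also have "\<dots> = (\<Squnion>\<^bsub>L\<^esub>((\<lambda>l. F l \<top>\<^bsub>L\<^esub>) ` ?N)) j"
        using F_closed
        by (intro sup_pres_sup[OF coordinate_sup_pres[OF j], symmetric]) (auto dest: funcset_mem)
      also have "\<Squnion>\<^bsub>L\<^esub>((\<lambda>l. F l \<top>\<^bsub>L\<^esub>) ` ?N) = f (\<lambda>l\<in>?N. \<top>\<^bsub>L\<^esub>)"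
        by (subst f_eq) (auto simp: Q cong: image_cong_simp)
      also have "\<dots> j = \<top>\<^bsub>Ls j\<^esub>" using f_top top_coord[OF j] by simp
      finally show ?thesis .
    qed
    moreover have "f x = \<Squnion>\<^bsub>L\<^esub>((\<lambda>l. cl (system_map I Ls (g l) (x l))) ` ?N)"
      if x: "x \<in> carrier ?Q" for x
    proof -
      \<comment> \<open>The system map already lands in \<open>L\<close>, where \<open>cl\<close> is
        the identity.\<close>
      have "cl (system_map I Ls (g l) (x l)) = F l (x l)" if "l \<in> ?N" for l
        using system[OF that] closure_fixed funcset_mem[OF F_closed] Q_coord[OF x that] by simp
      with f_eq[OF x] show ?thesis by (simp cong: image_cong_simp)
    qed
    ultimately show "\<exists>g. (\<forall>l\<in>?N. \<forall>i\<in>I. \<forall>j\<in>I.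
        g l i j \<in> carrier (Ls i) \<rightarrow> carrier (Ls j) \<and> sup_pres (Ls i) (Ls j) (g l i j)) \<and>
      (\<forall>j\<in>I. \<Squnion>\<^bsub>Ls j\<^esub>((\<lambda>l. \<Squnion>\<^bsub>Ls j\<^esub>((\<lambda>i. g l i j \<top>\<^bsub>Ls i\<^esub>) ` I)) ` ?N) = \<top>\<^bsub>Ls j\<^esub>) \<and>
      (\<forall>x\<in>carrier ?Q. f x = \<Squnion>\<^bsub>L\<^esub>((\<lambda>l. cl (system_map I Ls (g l) (x l))) ` ?N))"
      by (intro exI[of _ g]) blast
  next
    assume "\<exists>g. (\<forall>l\<in>?N. \<forall>i\<in>I. \<forall>j\<in>I.
        g l i j \<in> carrier (Ls i) \<rightarrow> carrier (Ls j) \<and> sup_pres (Ls i) (Ls j) (g l i j)) \<and>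
      (\<forall>j\<in>I. \<Squnion>\<^bsub>Ls j\<^esub>((\<lambda>l. \<Squnion>\<^bsub>Ls j\<^esub>((\<lambda>i. g l i j \<top>\<^bsub>Ls i\<^esub>) ` I)) ` ?N) = \<top>\<^bsub>Ls j\<^esub>) \<and>
      (\<forall>x\<in>carrier ?Q. f x = \<Squnion>\<^bsub>L\<^esub>((\<lambda>l. cl (system_map I Ls (g l) (x l))) ` ?N))"
    then obtain g where
      g: "\<And>l i j. l \<in> ?N \<Longrightarrow> i \<in> I \<Longrightarrow> j \<in> I \<Longrightarrow> g l i j \<in> carrier (Ls i) \<rightarrow> carrier (Ls j)"
      and g_sp: "\<And>l i j. l \<in> ?N \<Longrightarrow> i \<in> I \<Longrightarrow> j \<in> I \<Longrightarrow> sup_pres (Ls i) (Ls j) (g l i j)"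
      and g_top: "\<And>j. j \<in> I \<Longrightarrow>
        \<Squnion>\<^bsub>Ls j\<^esub>((\<lambda>l. \<Squnion>\<^bsub>Ls j\<^esub>((\<lambda>i. g l i j \<top>\<^bsub>Ls i\<^esub>) ` I)) ` ?N) = \<top>\<^bsub>Ls j\<^esub>"
      and f_eq: "\<And>x. x \<in> carrier ?Q \<Longrightarrow>
        f x = \<Squnion>\<^bsub>L\<^esub>((\<lambda>l. cl (system_map I Ls (g l) (x l))) ` ?N)"
      by blast
    define S where "S l = system_map I Ls (g l)" for l
    have S_closed: "S l \<in> carrier P \<rightarrow> carrier P" if "l \<in> ?N" for l
      unfolding S_def using factor_complete g[OF that] by (rule system_map_closed)
    have S_sp: "sup_pres P P (S l)" if "l \<in> ?N" for l
      unfolding S_def using factor_complete g[OF that] g_sp[OF that] by (rule system_map_sup_pres)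
    have Q_coord_P: "x l \<in> carrier P" if "x \<in> carrier ?Q" "l \<in> ?N" for x l
      using Q_coord[OF that] carrier_subset by (rule subsetD[rotated])
    have clS: "cl (S l z) \<in> carrier L" if "l \<in> ?N" "z \<in> carrier L" for l z
      using that carrier_subset
      by (intro funcset_mem[OF closure_closed] funcset_mem[OF S_closed]) auto
    \<comment> \<open>Each \<open>l\<close> contributes a chain of sup-preserving maps: the
      projection to position \<open>l\<close>, the inclusion into the product, \<open>S l\<close>
      and \<open>cl\<close>. Their pointwise supremum preserves suprema as well.\<close>
    have "sup_pres ?Q L (\<lambda>x. \<Squnion>\<^bsub>L\<^esub>((\<lambda>l. cl (S l (x l))) ` ?N))"
    proof (rule sup_pres_pointwise_sup[OF Q_complete L_complete])
      fix l assume l: "l \<in> ?N"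
      show "(\<lambda>x. cl (S l (x l))) \<in> carrier ?Q \<rightarrow> carrier L"
        using Q_coord clS l by blast
      have "sup_pres ?Q L (\<lambda>x. x l)"
        unfolding Q by (rule sup_pres_product_proj[where Ls = "\<lambda>_. L", OF L_complete l])
      then have "sup_pres ?Q P (\<lambda>x. x l)"
        by (rule sup_pres_comp[OF _ inclusion_sup_pres]) (use Q_coord l in blast)
      then have "sup_pres ?Q P (\<lambda>x. S l (x l))"
        by (rule sup_pres_comp[OF _ S_sp[OF l]]) (use Q_coord_P l in blast)
      then show "sup_pres ?Q L (\<lambda>x. cl (S l (x l)))"
        by (rule sup_pres_comp[OF _ closure_sup_pres])
          (intro funcsetI funcset_mem[OF S_closed[OF l]] Q_coord_P l)
    qed
    then have sp: "sup_pres ?Q L f"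
      unfolding S_def by (subst sup_pres_cong[OF f_eq])
    have "f (\<lambda>l\<in>?N. \<bottom>\<^bsub>L\<^esub>) = \<bottom>\<^bsub>L\<^esub>"
      using sup_pres_bottom[OF sp] by (simp add: Q_bottom)
    \<comment> \<open>With \<open>?t\<close> the value at the top tuple, it suffices that
      \<open>?t\<close> lies above the join over \<open>l\<close> of \<open>S l\<close> at the top,
      since \<open>g_top\<close> makes this join the top in every coordinate.\<close>
    moreover have "f (\<lambda>l\<in>?N. \<top>\<^bsub>L\<^esub>) = \<top>\<^bsub>L\<^esub>"
    proof (rule L.le_antisym)
      let ?t = "f (\<lambda>l\<in>?N. \<top>\<^bsub>L\<^esub>)"
      have top_in: "(\<lambda>l\<in>?N. \<top>\<^bsub>L\<^esub>) \<in> carrier ?Q" by (simp add: Q)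
      then show t: "?t \<in> carrier L" by (rule funcset_mem[OF assms(6)])
      then show "?t \<sqsubseteq>\<^bsub>L\<^esub> \<top>\<^bsub>L\<^esub>" by (rule L.top_higher)
      have tP: "\<top>\<^bsub>L\<^esub> \<in> carrier P" using carrier_subset L.top_closed by blast
      have "?t = \<Squnion>\<^bsub>L\<^esub>((\<lambda>l. cl (S l \<top>\<^bsub>L\<^esub>)) ` ?N)"
        using f_eq[OF top_in] by (simp add: S_def cong: image_cong_simp)
      then have "cl (S l \<top>\<^bsub>L\<^esub>) \<sqsubseteq>\<^bsub>L\<^esub> ?t" if "l \<in> ?N" for l
        using that clS by (auto intro!: L.sup_upper)
      \<comment> \<open>The adjunction removes \<open>cl\<close>, turning an inequality in
        \<open>L\<close> into one in the product that can be read off coordinatewise.\<close>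
      then have S_le: "S l \<top>\<^bsub>L\<^esub> \<sqsubseteq>\<^bsub>P\<^esub> ?t" if "l \<in> ?N" for l
        using closure_adjoint[OF funcset_mem[OF S_closed tP] t] that by blast
      have "\<top>\<^bsub>L\<^esub> j \<sqsubseteq>\<^bsub>Ls j\<^esub> ?t j" if j: "j \<in> I" for j
      proof -
        interpret Lj: complete_lattice "Ls j" using j by (rule factor_complete)
        have "\<top>\<^bsub>L\<^esub> j = \<Squnion>\<^bsub>Ls j\<^esub>((\<lambda>l. S l \<top>\<^bsub>L\<^esub> j) ` ?N)"
          using g_top[OF j] j by (simp add: S_def system_map_def top_coord cong: image_cong_simp)
        also have "\<dots> \<sqsubseteq>\<^bsub>Ls j\<^esub> ?t j"
        proof (rule Lj.sup_least)
          show "(\<lambda>l. S l \<top>\<^bsub>L\<^esub> j) ` ?N \<subseteq> carrier (Ls j)"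
            using funcset_mem[OF S_closed tP] j by fastforce
          show "?t j \<in> carrier (Ls j)" using t by (rule funcset_mem[OF coordinate_closed[OF j]])
        qed (use S_le j in \<open>auto simp: le_product_lattice\<close>)
        finally show ?thesis .
      qed
      then have "\<top>\<^bsub>L\<^esub> \<sqsubseteq>\<^bsub>P\<^esub> ?t" by (simp add: le_product_lattice)
      then show "\<top>\<^bsub>L\<^esub> \<sqsubseteq>\<^bsub>L\<^esub> ?t" using le_eq[OF L.top_closed t] by simp
    qed simp
    ultimately show "aggregation_function n L f \<and> sup_pres ?Q L f"
      using sp assms(6) sup_pres_isotone[OF sp assms(6)] by (simp add: aggregation_function_def)
  }
qed

end
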